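(* Let $w\in\{2,4,6,8,10,12\}$ and let $n\geq 2$ be an integer. Then $M(w,n)$ equals the least nonnegative integer $k$ such that $k\equiv wn \pmod 4$ and such that $k=0$ only if both $w$ and $n$ are multiples of $4$ (that is, $M(w,n)=0$ if $4\mid w$ and $4\mid n$; $M(w,n)=2$ if $wn\equiv 2\pmod 4$; and $M(w,n)=4$ if $wn\equiv 0\pmod 4$ but not both $w,n$ are multiples of $4$), with only the following exceptions: $M(10, n) = 6$ for $n \in\{3, 7, 11, 15, 19, 23\}$.
   Context: The $T$-tetromino is the polyomino formed by four unit squares: three in a row together with a fourth square attached to the middle square of that row. A tiling of an $m\times n$ rectangle (of unit cells) by $T$-tetrominos and monominos is a partition of its cells into copies of the $T$-tetromino (in any rotation or reflection, aligned with the grid) and single cells (monominos). The gap number $M(m,n)$ is the least number of monominos occurring in such a tiling of the $m\times n$ rectangle. *)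

theory Defs
  imports "HOL-Library.Disjoint_Sets" "HOL-Number_Theory.Cong"
begin

text \<open>The unit cell with lower left corner \<open>(i, j)\<close> is represented by the pair \<open>(i, j)\<close>.\<close>

type_synonym cell = "int \<times> int"

definition rectangle :: "nat \<Rightarrow> nat \<Rightarrow> cell set" where
  "rectangle m n = {0..<int m} \<times> {0..<int n}"

text \<open>The symmetries of the grid: the eight signed coordinate permutations (rotations by
  multiples of a right angle and reflections), followed by a translation.\<close>

definition grid_symmetries :: "(cell \<Rightarrow> cell) set" where
  "grid_symmetries =
     {(\<lambda>(x, y). (a + s * x, b + t * y)) | a b s t. s \<in> {1, -1} \<and> t \<in> {1, -1}} \<union>
     {(\<lambda>(x, y). (a + s * y, b + t * x)) | a b s t. s \<in> {1, -1} \<and> t \<in> {1, -1}}"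

definition T_tetromino :: "cell set" where
  "T_tetromino = {(0, 0), (1, 0), (2, 0), (1, 1)}"

definition is_T_tetromino :: "cell set \<Rightarrow> bool" where
  "is_T_tetromino p \<longleftrightarrow> (\<exists>f \<in> grid_symmetries. p = f ` T_tetromino)"

definition is_monomino :: "cell set \<Rightarrow> bool" where
  "is_monomino p \<longleftrightarrow> (\<exists>c. p = {c})"

definition is_tiling :: "nat \<Rightarrow> nat \<Rightarrow> cell set set \<Rightarrow> bool" where
  "is_tiling m n P \<longleftrightarrow>
     partition_on (rectangle m n) P \<and> (\<forall>p \<in> P. is_T_tetromino p \<or> is_monomino p)"

definition gap_number :: "nat \<Rightarrow> nat \<Rightarrow> nat" where
  "gap_number m n = (LEAST k. \<exists>P. is_tiling m n P \<and> k = card {p \<in> P. is_monomino p})"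

end

theory Submission
  imports Defs
begin

text \<open>
  A rectangle of width \<open>w\<close> is filled row by row, from left to right, each time placing the piece that
  covers the first free cell. The pieces placed before row \<open>y\<close> fill the rows below \<open>y\<close> and stick out
  by at most two rows, so all that matters is the \<^emph>\<open>profile\<close>: for each column, which of the cells in
  rows \<open>y\<close> and \<open>y + 1\<close> are occupied. Tilings with \<open>k\<close> monominos are thus walks from the flat profile to
  itself, with \<open>k\<close> monominos used in total, in a finite graph of profiles.

  Without monominos only few profiles can be reached. For \<open>w = 2, 6, 10\<close> they die out within four
  rows; for \<open>w = 4, 8, 12\<close> they become periodic with period four and the flat profile occurs only after a
  multiple of four rows. As the number of monominos is congruent to \<open>w n\<close> modulo 4, this gives all lower
  bounds but the exceptional ones. In the exceptional cases, two monominos would have to suffice for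
  width 10. Since four rows cannot be completed without a monomino, reflecting the tiling shows that
  one of the two lies in the last four rows, so at most one is used before. Hence it suffices to
  follow walks with at most one monomino up to there, and all their continuations by four more rows.

  The upper bounds are walks through a profile that lies on a cycle of four rows without monominos.
\<close>

section \<open>Profiles and rows\<close>

text \<open>
  In a configuration \<open>(k, ls, rs)\<close>, row \<open>y\<close> is filled up to column \<open>length ls\<close> and exactly \<open>k\<close> monominos
  are still to be placed in this row. The list \<open>ls\<close> describes the columns already passed, nearest
  first, by the occupancy of their cells in rows \<open>y + 1\<close> and \<open>y + 2\<close>; the list \<open>rs\<close> describes the
  remaining columns by the occupancy of their cells in rows \<open>y\<close> and \<open>y + 1\<close>. A cell of \<open>rs\<close> in row
  \<open>y + 2\<close> is always free, because only a piece starting in its own column can reach it.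
\<close>

type_synonym column = "bool \<times> bool"
type_synonym config = "nat \<times> column list \<times> column list"

text \<open>
  The four orientations of the tetromino are named after the direction in which its fourth cell
  points, with the second coordinate growing to the north; \<open>M\<close> is the monomino.
\<close>

datatype piece = N | E | S | W | M

text \<open>The patterns test only the cells beyond the anchor itself; that the anchor cell is free
  is ensured by \<open>put\<close>. A match means that the piece overlaps nothing and stays within
  the columns.\<close>

fun north :: "nat \<Rightarrow> column list \<Rightarrow> column list \<Rightarrow> config option" where
  "north k ls ((a, b) # (False, False) # (False, b') # rs) =
     Some (k, (b, False) # ls, (True, True) # (True, b') # rs)"
| "north k ls rs = None"

fun east :: "nat \<Rightarrow> column list \<Rightarrow> column list \<Rightarrow> config option" where
  "east k ls ((a, False) # (a', False) # rs) = Some (k, (True, True) # ls, (a', True) # rs)"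
| "east k ls rs = None"

fun south :: "nat \<Rightarrow> column list \<Rightarrow> column list \<Rightarrow> config option" where
  "south k ((False, c) # ls) ((a, False) # (a', False) # rs) =
     Some (k, (True, False) # (True, c) # ls, (a', True) # rs)"
| "south k ls rs = None"

fun west :: "nat \<Rightarrow> column list \<Rightarrow> column list \<Rightarrow> config option" where
  "west k ((False, c) # ls) ((a, False) # rs) = Some (k, (True, True) # (True, c) # ls, rs)"
| "west k ls rs = None"

fun single :: "nat \<Rightarrow> column list \<Rightarrow> column list \<Rightarrow> config option" where
  "single (Suc k) ls ((a, b) # rs) = Some (k, (b, False) # ls, rs)"
| "single k ls rs = None"

fun place :: "piece \<Rightarrow> nat \<Rightarrow> column list \<Rightarrow> column list \<Rightarrow> config option" where
  "place N = north"
| "place E = east"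
| "place S = south"
| "place W = west"
| "place M = single"

inductive fill_row :: "config \<Rightarrow> column list \<Rightarrow> bool" where
  finish: "fill_row (0, ls, []) (rev ls)"
| skip: "fill_row (k, (b, False) # ls, rs) s \<Longrightarrow> fill_row (k, ls, (True, b) # rs) s"
| put: "place m k ls ((False, b) # rs) = Some c \<Longrightarrow> fill_row c s \<Longrightarrow>
    fill_row (k, ls, (False, b) # rs) s"

inductive walk :: "nat \<Rightarrow> nat \<Rightarrow> column list \<Rightarrow> column list \<Rightarrow> bool" where
  walk_0: "walk 0 0 s s"
| walk_Suc: "walk r k s s' \<Longrightarrow> fill_row (j, [], s') s'' \<Longrightarrow> walk (Suc r) (k + j) s s''"

abbreviation flat :: "nat \<Rightarrow> column list" where
  "flat w \<equiv> replicate w (False, False)"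

section \<open>Covered cells\<close>

fun left_cells :: "int \<Rightarrow> int \<Rightarrow> column list \<Rightarrow> cell set" where
  "left_cells x y [] = {}"
| "left_cells x y ((b, c) # ls) =
     {(x - 1, y)} \<union> (if b then {(x - 1, y + 1)} else {}) \<union> (if c then {(x - 1, y + 2)} else {}) \<union>
     left_cells (x - 1) y ls"

fun right_cells :: "int \<Rightarrow> int \<Rightarrow> column list \<Rightarrow> cell set" where
  "right_cells x y [] = {}"
| "right_cells x y ((a, b) # rs) =
     (if a then {(x, y)} else {}) \<union> (if b then {(x, y + 1)} else {}) \<union> right_cells (x + 1) y rs"

definition covered :: "int \<Rightarrow> column list \<Rightarrow> column list \<Rightarrow> cell set" where
  "covered y ls rs = {0..<int (length ls + length rs)} \<times> {0..<y} \<union>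
     left_cells (int (length ls)) y ls \<union> right_cells (int (length ls)) y rs"

text \<open>The anchor is the first cell of the piece in row-major order.\<close>

fun cells_of :: "piece \<Rightarrow> cell \<Rightarrow> cell set" where
  "cells_of N (x, y) = {(x, y), (x + 1, y), (x + 2, y), (x + 1, y + 1)}"
| "cells_of E (x, y) = {(x, y), (x, y + 1), (x, y + 2), (x + 1, y + 1)}"
| "cells_of S (x, y) = {(x, y), (x - 1, y + 1), (x, y + 1), (x + 1, y + 1)}"
| "cells_of W (x, y) = {(x, y), (x, y + 1), (x, y + 2), (x - 1, y + 1)}"
| "cells_of M (x, y) = {(x, y)}"

lemma left_cells_subset:
  "left_cells x y ls \<subseteq> {x - int (length ls)..<x} \<times> {y..y + 2}"
  by (induction x y ls rule: left_cells.induct) (auto split: if_splits)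

lemma left_cells_bottom: "(u, y) \<in> left_cells x y ls \<longleftrightarrow> x - int (length ls) \<le> u \<and> u < x"
  by (induction x y ls rule: left_cells.induct) auto

lemma right_cells_subset:
  "right_cells x y rs \<subseteq> {x..<x + int (length rs)} \<times> {y..y + 1}"
  by (induction x y rs rule: right_cells.induct) (auto split: if_splits)

lemma left_cellsD:
  "(u, v) \<in> left_cells x y ls \<Longrightarrow> x - int (length ls) \<le> u \<and> u < x \<and> y \<le> v \<and> v \<le> y + 2"
  using left_cells_subset by fastforce

lemma right_cellsD:
  "(u, v) \<in> right_cells x y rs \<Longrightarrow> x \<le> u \<and> u < x + int (length rs) \<and> y \<le> v \<and> v \<le> y + 1"
  using right_cells_subset by fastforce

lemma not_left_cells: "x \<le> u \<Longrightarrow> (u, v) \<notin> left_cells x y ls"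
  using left_cellsD by fastforce

lemma not_right_cells: "u < x \<Longrightarrow> (u, v) \<notin> right_cells x y rs"
  using right_cellsD by fastforce

text \<open>At the end of a row the occupancies in rows \<open>y + 1\<close> and
  \<open>y + 2\<close> become the profile of the next row; the reversal appears because
  \<open>ls\<close> lists the nearest column first.\<close>

lemma left_cells_rev:
  "left_cells x y ls =
     {x - int (length ls)..<x} \<times> {y} \<union> right_cells (x - int (length ls)) (y + 1) (rev ls)"
proof -
  have app: "right_cells x y (rs @ rs') = right_cells x y rs \<union> right_cells (x + int (length rs)) y rs'"
    for x y rs rs'
    by (induction x y rs rule: right_cells.induct) (auto simp: algebra_simps)
  show ?thesis
  proof (induction x y ls rule: left_cells.induct)
    case (2 x y b c ls)
    have *: "{x - int (length ((b, c) # ls))..<x} = insert (x - 1) {x - 1 - int (length ls)..<x - 1}"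
      by auto
    have **: "x - int (length ((b, c) # ls)) = x - 1 - int (length ls)"
      by simp
    show ?case
      unfolding left_cells.simps 2 rev.simps app * unfolding ** by auto
  qed simp
qed

lemma covered_finish: 
  assumes "0 \<le> y"
  shows "covered y ls [] = covered (y + 1) [] (rev ls)"
  using assms by (auto simp: covered_def left_cells_rev)

lemma covered_skip: "covered y ls ((True, b) # rs) = covered y ((b, False) # ls) rs"
  by (auto simp: covered_def algebra_simps)

lemma not_covered_head: "0 \<le> y \<Longrightarrow> (int (length ls), y) \<notin> covered y ls ((False, b) # rs)"
  by (auto simp: covered_def dest: left_cellsD right_cellsD)

section \<open>Placing a single piece\<close>

lemma north_Some:
  "north k ls rs0 = Some c \<longleftrightarrow> (\<exists>a b b' rs. rs0 = (a, b) # (False, False) # (False, b') # rs \<and>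
     c = (k, (b, False) # ls, (True, True) # (True, b') # rs))"
  by (cases "(k, ls, rs0)" rule: north.cases) auto

lemma east_Some:
  "east k ls rs0 = Some c \<longleftrightarrow> (\<exists>a a' rs. rs0 = (a, False) # (a', False) # rs \<and>
     c = (k, (True, True) # ls, (a', True) # rs))"
  by (cases "(k, ls, rs0)" rule: east.cases) auto

lemma south_Some:
  "south k ls0 rs0 = Some c \<longleftrightarrow> (\<exists>z ls a a' rs. ls0 = (False, z) # ls \<and>
     rs0 = (a, False) # (a', False) # rs \<and> c = (k, (True, False) # (True, z) # ls, (a', True) # rs))"
  by (cases "(k, ls0, rs0)" rule: south.cases) auto

lemma west_Some:
  "west k ls0 rs0 = Some c \<longleftrightarrow> (\<exists>z ls a rs. ls0 = (False, z) # ls \<and> rs0 = (a, False) # rs \<and>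
     c = (k, (True, True) # (True, z) # ls, rs))"
  by (cases "(k, ls0, rs0)" rule: west.cases) auto

lemma single_Some:
  "single k0 ls rs0 = Some c \<longleftrightarrow> (\<exists>k a b rs. k0 = Suc k \<and> rs0 = (a, b) # rs \<and>
     c = (k, (b, False) # ls, rs))"
  by (cases "(k0, ls, rs0)" rule: single.cases) auto

lemmas place_Some = north_Some east_Some south_Some west_Some single_Some

lemma place_length:
  assumes "place m k ls rs = Some (k', ls', rs')"
  shows "length ls' = Suc (length ls)" and "length rs = Suc (length rs')"
    and "k = k' + (if m = M then 1 else 0)"
  using assms by (cases m; auto simp: place_Some)+

lemma place_covered:
  assumes "place m k ls ((False, b) # rs) = Some (k', ls', rs')"
  shows "covered y ls' rs' = covered y ls ((False, b) # rs) \<union> cells_of m (int (length ls), y)"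
proof (cases m)
  case N
  with assms show ?thesis
    by (clarsimp simp: place_Some) (simp add: covered_def add_ac, blast)
next
  case E
  with assms show ?thesis
    by (clarsimp simp: place_Some) (simp add: covered_def add_ac, blast)
next
  case S
  with assms show ?thesis
    by (clarsimp simp: place_Some) (simp add: covered_def add_ac, blast)
next
  case W
  with assms show ?thesis
    by (clarsimp simp: place_Some) (simp add: covered_def add_ac, blast)
next
  case M
  with assms show ?thesis
    by (clarsimp simp: place_Some) (simp add: covered_def add_ac)
qed

lemma place_disjoint:
  assumes "place m k ls ((False, b) # rs) = Some c" "0 \<le> y"
  shows "covered y ls ((False, b) # rs) \<inter> cells_of m (int (length ls), y) = {}"
  using assms
  by (cases m) (auto simp: place_Some covered_def not_left_cells not_right_cells split: if_splits)

text \<open>Converse of \<open>place_disjoint\<close>: staying within the columns provides the list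
  entries that the pattern of \<open>place\<close> asks for, and disjointness makes the relevant
  ones \<open>False\<close>. A monomino only needs a positive budget.\<close>

lemma place_exists:
  assumes disj: "cells_of m (int (length ls), y) \<inter> covered y ls ((False, b) # rs) = {}"
    and sub: "cells_of m (int (length ls), y) \<subseteq> {0..<int (length ls + Suc (length rs))} \<times> UNIV"
    and "m = M \<Longrightarrow> 0 < k"
  shows "\<exists>c. place m k ls ((False, b) # rs) = Some c"
proof -
  show ?thesis
  proof (cases m)
    case N
    then have "2 \<le> length rs"
      using sub by auto
    then obtain c1 c2 rs' where "rs = c1 # c2 # rs'"
      by (auto simp: Suc_le_length_iff numeral_2_eq_2)
    then show ?thesis
      using disj N by (cases c1; cases c2) (auto simp: place_Some covered_def add_ac split: if_splits)
  next
    case E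
    then have "rs \<noteq> []"
      using sub by auto
    then obtain c1 rs' where "rs = c1 # rs'"
      by (auto simp: neq_Nil_conv)
    then show ?thesis
      using disj E by (cases c1) (auto simp: place_Some covered_def add_ac split: if_splits)
  next
    case S
    then have "rs \<noteq> []" "ls \<noteq> []"
      using sub by auto
    then obtain c1 rs' c2 ls' where "rs = c1 # rs'" "ls = c2 # ls'"
      by (auto simp: neq_Nil_conv)
    then show ?thesis
      using disj S by (cases c1; cases c2) (auto simp: place_Some covered_def add_ac split: if_splits)
  next
    case W
    then have "ls \<noteq> []"
      using sub by auto
    then obtain c2 ls' where "ls = c2 # ls'"
      by (auto simp: neq_Nil_conv)
    then show ?thesis
      using disj W by (cases c2) (auto simp: place_Some covered_def add_ac split: if_splits)
  next
    case M
    then show ?thesis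
      using assms(3) by (cases k) auto
  qed
qed

section \<open>Oriented tetrominoes and their anchors\<close>

lemma is_T_tetromino_iff: "is_T_tetromino p \<longleftrightarrow> (\<exists>m c. m \<noteq> M \<and> p = cells_of m c)"
proof
  assume "is_T_tetromino p"
  then obtain f where f: "f \<in> grid_symmetries" "p = f ` T_tetromino"
    unfolding is_T_tetromino_def by blast
  from f(1) consider a b s t where "s = 1 \<or> s = -1" "t = 1 \<or> t = -1"
      "f = (\<lambda>(x, y). (a + s * x, b + t * y))"
    | a b s t where "s = 1 \<or> s = -1" "t = 1 \<or> t = -1" "f = (\<lambda>(x, y). (a + s * y, b + t * x))"
    unfolding grid_symmetries_def by blast
  then show "\<exists>m c. m \<noteq> M \<and> p = cells_of m c"
  proof cases
    case (1 a b s t)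
    have "p = {(a, b), (a + s, b), (a + 2 * s, b), (a + s, b + t)}"
      unfolding f(2) 1(3) T_tetromino_def by (simp add: insert_commute mult.commute)
    \<comment> \<open>The sign \<open>s\<close> merely reverses the bar, so eight symmetries yield
      four orientations. For \<open>t = -1\<close> the fourth cell is the lowest one and hence the
      anchor.\<close>
    then have "p = cells_of (if t = 1 then N else S)
        (if t = 1 then (min a (a + 2 * s), b) else (a + s, b - 1))"
      using 1(1,2) by auto
    moreover have "(if t = 1 then N else S) \<noteq> M"
      by simp
    ultimately show ?thesis
      by blast
  next
    case (2 a b s t)
    have "p = {(a, b), (a, b + t), (a, b + 2 * t), (a + s, b + t)}"
      unfolding f(2) 2(3) T_tetromino_def by (simp add: insert_commute mult.commute)
    then have "p = cells_of (if s = 1 then E else W) (a, min b (b + 2 * t))"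
      using 2(1,2) by auto
    moreover have "(if s = 1 then E else W) \<noteq> M"
      by simp
    ultimately show ?thesis
      by blast
  qed
next
  assume "\<exists>m c. m \<noteq> M \<and> p = cells_of m c"
  then obtain m x y where m: "m \<noteq> M" "p = cells_of m (x, y)"
    by auto
  have sym: "(\<lambda>(u, v). (a + s * u, b + t * v)) \<in> grid_symmetries"
    "(\<lambda>(u, v). (a + s * v, b + t * u)) \<in> grid_symmetries" if "s \<in> {1, -1}" "t \<in> {1, -1}" for a b s t
    unfolding grid_symmetries_def using that by blast+
  show "is_T_tetromino p"
    unfolding is_T_tetromino_def
  proof (cases m)
    case N
    then show "\<exists>f\<in>grid_symmetries. p = f ` T_tetromino"
      using m(2) by (intro bexI[OF _ sym(1)[of 1 1 x y]]) (auto simp: T_tetromino_def)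
  next
    case E
    then show "\<exists>f\<in>grid_symmetries. p = f ` T_tetromino"
      using m(2) by (intro bexI[OF _ sym(2)[of 1 1 x y]]) (auto simp: T_tetromino_def)
  next
    case S
    then show "\<exists>f\<in>grid_symmetries. p = f ` T_tetromino"
      using m(2) by (intro bexI[OF _ sym(1)[of 1 "-1" "x - 1" "y + 1"]]) (auto simp: T_tetromino_def)
  next
    case W
    then show "\<exists>f\<in>grid_symmetries. p = f ` T_tetromino"
      using m(2) by (intro bexI[OF _ sym(2)[of "-1" 1 x y]]) (auto simp: T_tetromino_def)
  qed (use m in simp)
qed

text \<open>Every tetromino contains its anchor and has no earlier cell in row-major order. So the
  piece over the first free cell is anchored there.\<close>

lemma cells_of_lex_least:
  assumes "is_T_tetromino p" "(x, y) \<in> p" "\<And>u v. (u, v) \<in> p \<Longrightarrow> y < v \<or> v = y \<and> x \<le> u"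
  shows "\<exists>m. m \<noteq> M \<and> p = cells_of m (x, y)"
proof -
  obtain m x' y' where m: "m \<noteq> M" "p = cells_of m (x', y')"
    using assms(1) by (auto simp: is_T_tetromino_iff)
  have "(x', y') \<in> p"
    using m by (cases m) auto
  moreover have "y' < y \<or> y' = y \<and> x' \<le> x"
    using m assms(2) by (cases m) auto
  ultimately have "(x', y') = (x, y)"
    using assms(3)[of x' y'] by auto
  then show ?thesis
    using m by blast
qed

lemma is_T_tetromino_card: "is_T_tetromino p \<Longrightarrow> card p = 4"
proof -
  assume "is_T_tetromino p"
  then obtain m x y where m: "m \<noteq> M" "p = cells_of m (x, y)"
    by (auto simp: is_T_tetromino_iff)
  then show ?thesis
    by (cases m) auto
qed

lemma is_T_tetromino_not_monomino: "is_T_tetromino p \<Longrightarrow> \<not> is_monomino p"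
  by (auto dest!: is_T_tetromino_card simp: is_monomino_def)

lemma is_monomino_cells_of: "is_monomino (cells_of m c) \<longleftrightarrow> m = M"
proof (cases "m = M")
  case True
  then show ?thesis
    by (cases c) (auto simp: is_monomino_def)
next
  case False
  then show ?thesis
    using is_T_tetromino_not_monomino is_T_tetromino_iff by blast
qed

section \<open>Tilings as walks\<close>

lemma walk_split: "walk (a + b) k s s'' \<Longrightarrow> \<exists>i j s'. k = i + j \<and> walk a i s s' \<and> walk b j s' s''"
proof (induction b arbitrary: k s'')
  case 0
  then show ?case
    using walk_0 by force
next
  case (Suc b)
  from Suc.prems obtain k' j u where u: "walk (a + b) k' s u" "fill_row (j, [], u) s''" "k = k' + j"
    by (auto elim: walk.cases)
  then obtain i j' s' where "k' = i + j'" "walk a i s s'" "walk b j' s' u"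
    using Suc.IH by blast
  then show ?case
    using u walk_Suc by (metis add.assoc)
qed

lemma walk_trans: "walk b j s' s'' \<Longrightarrow> walk a i s s' \<Longrightarrow> walk (a + b) (i + j) s s''"
proof (induction rule: walk.induct)
  case (walk_Suc r k s' u j s'')
  then show ?case
    using walk.walk_Suc[of "a + r" "i + k"] by (simp add: add.assoc)
qed simp

section \<open>From walks to tilings\<close>

definition tiled :: "cell set \<Rightarrow> nat \<Rightarrow> bool" where
  "tiled R k \<longleftrightarrow> (\<exists>P. partition_on R P \<and> finite P \<and>
     (\<forall>p\<in>P. is_T_tetromino p \<or> is_monomino p) \<and> card {p \<in> P. is_monomino p} = k)"

lemma tiled_Un_cells_of:
  assumes "tiled R k" "R \<inter> cells_of m c = {}"
  shows "tiled (R \<union> cells_of m c) (k + (if m = M then 1 else 0))"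
proof -
  obtain P where P: "partition_on R P" "finite P" "\<forall>p\<in>P. is_T_tetromino p \<or> is_monomino p"
      "card {p \<in> P. is_monomino p} = k"
    using assms(1) unfolding tiled_def by blast
  let ?p = "cells_of m c"
  have ne: "?p \<noteq> {}"
    by (cases c; cases m) auto
  have new: "?p \<notin> P"
    using P(1) assms(2) ne unfolding partition_on_def by blast
  have "partition_on (R \<union> ?p) (insert ?p P)"
  proof (subst partition_on_insert)
    show "disjnt ?p (\<Union>P)"
      using partition_onD1[OF P(1)] assms(2) by (auto simp: disjnt_def)
    have "R \<union> ?p - ?p = R"
      using assms(2) by blast
    then show "partition_on (R \<union> ?p - ?p) P \<and> ?p \<subseteq> R \<union> ?p \<and> ?p \<noteq> {}"
      using P(1) ne by simp
  qed
  moreover have "is_T_tetromino ?p \<or> is_monomino ?p"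
    using is_T_tetromino_iff is_monomino_cells_of by blast
  moreover have "{p \<in> insert ?p P. is_monomino p} =
      (if m = M then insert ?p {p \<in> P. is_monomino p} else {p \<in> P. is_monomino p})"
    using is_monomino_cells_of[of m c] by auto
  ultimately show ?thesis
    unfolding tiled_def using P new by (intro exI[of _ "insert ?p P"]) auto
qed

text \<open>Each \<open>put\<close> adds one piece disjoint from the covered region, and the budget
  falls exactly when this piece is a monomino; \<open>skip\<close> and \<open>finish\<close> only
  redescribe the region.\<close>

lemma tiled_fill_row:
  assumes "fill_row (k, ls, rs) s" "tiled (covered y ls rs) j" "0 \<le> y"
  shows "tiled (covered (y + 1) [] s) (j + k)"
  using assms
proof (induction "(k, ls, rs)" s arbitrary: k ls rs j rule: fill_row.induct)
  case (finish ls)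
  then show ?case
    by (simp add: covered_finish)
next
  case (skip k b ls rs s)
  then show ?case
    by (simp add: covered_skip)
next
  case (put m k ls b rs c s)
  obtain k' ls' rs' where c: "c = (k', ls', rs')"
    by (cases c)
  have "tiled (covered y ls' rs') (j + (if m = M then 1 else 0))"
    using tiled_Un_cells_of[OF _ place_disjoint[OF put.hyps(1)]] put.prems
      place_covered[OF put.hyps(1)[unfolded c]] by simp
  then show ?case
    using put.hyps(3)[OF c] put.prems place_length(3)[OF put.hyps(1)[unfolded c]]
    by (fastforce simp: add_ac)
qed

lemma tiled_walk:
  assumes "walk r k s s'" "tiled (covered y [] s) j" "0 \<le> y"
  shows "tiled (covered (y + int r) [] s') (j + k)"
  using assms
proof (induction rule: walk.induct)
  case (walk_Suc r k s s' j' s'')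
  then show ?case
    using tiled_fill_row[OF walk_Suc.hyps(2), of "y + int r" "j + k"] by (simp add: add_ac)
qed simp

lemma right_cells_flat: "right_cells x y (flat w) = {}"
  by (induction w arbitrary: x) auto

lemma covered_flat: "covered (int n) [] (flat w) = rectangle w n"
  by (auto simp: covered_def rectangle_def right_cells_flat)

lemma tiling_of_walk:
  assumes "walk n k (flat w) (flat w)"
  shows "\<exists>P. is_tiling w n P \<and> k = card {p \<in> P. is_monomino p}"
proof -
  have "tiled (covered 0 [] (flat w)) 0"
    unfolding tiled_def covered_def right_cells_flat
    by (intro exI[of _ "{}"]) (auto simp: partition_on_def)
  from tiled_walk[OF assms this] have "tiled (rectangle w n) k"
    by (simp add: covered_flat)
  then show ?thesis
    unfolding tiled_def is_tiling_def by blast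
qed

section \<open>From tilings to walks\<close>

definition row_count :: "cell set set \<Rightarrow> int \<Rightarrow> nat" where
  "row_count P y = card {x. {(x, y)} \<in> P}"

lemma tiling_singleton_bounds:
  assumes "is_tiling w n P" "{(x, y)} \<in> P"
  shows "0 \<le> x \<and> x < int w \<and> 0 \<le> y \<and> y < int n"
proof -
  have "(x, y) \<in> rectangle w n"
    using assms partition_onD1 unfolding is_tiling_def by blast
  then show ?thesis
    by (simp add: rectangle_def)
qed

text \<open>Induction on the number of remaining columns, with \<open>Q\<close> the pieces of
  \<open>P\<close> placed so far. The budget is the number of monominos of \<open>P\<close> in row
  \<open>y\<close> from the current column on, so it is exhausted exactly at the end of the
  row.\<close>

lemma tiling_fill_row:
  assumes P: "is_tiling w n P" and y: "0 \<le> y" "y < int n"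
  assumes "Q \<subseteq> P" "\<Union>Q = covered y ls rs" "length ls + length rs = w"
    and "\<And>x v. {(x, v)} \<in> Q \<Longrightarrow> v < y \<or> v = y \<and> x < int (length ls)"
  shows "\<exists>Q' s. Q' \<subseteq> P \<and> \<Union>Q' = covered (y + 1) [] s \<and> length s = w \<and>
    (\<forall>x v. {(x, v)} \<in> Q' \<longrightarrow> v < y + 1) \<and>
    fill_row (card {x. int (length ls) \<le> x \<and> {(x, y)} \<in> P}, ls, rs) s"
  using assms(4-)
proof (induction "length rs" arbitrary: ls rs Q)
  case 0
  have empty: "{x. int (length ls) \<le> x \<and> {(x, y)} \<in> P} = {}"
    using tiling_singleton_bounds[OF P] 0 by fastforce
  have "fill_row (card {x. int (length ls) \<le> x \<and> {(x, y)} \<in> P}, ls, rs) (rev ls)"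
    unfolding empty using 0 fill_row.finish[of ls] by simp
  moreover have "v < y + 1" if "{(u, v)} \<in> Q" for u v
    using 0(5)[OF that] by auto
  ultimately show ?case
    using 0 covered_finish[OF y(1), of ls]
    by (intro exI[of _ Q] exI[of _ "rev ls"]) auto
next
  case (Suc r)
  have rect: "\<Union>P = rectangle w n" and part: "partition_on (rectangle w n) P"
    and tiles: "\<And>p. p \<in> P \<Longrightarrow> is_T_tetromino p \<or> is_monomino p"
    using P unfolding is_tiling_def partition_on_def by blast+
  have meet: "p = q" if "p \<in> P" "q \<in> P" "c \<in> p" "c \<in> q" for p q c
    using partition_onD2[OF part] that by (auto simp: disjoint_def)
  define x where "x = int (length ls)"
  let ?k = "\<lambda>z. card {x. z \<le> x \<and> {(x, y)} \<in> P}"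
  have fin: "finite {x. z \<le> x \<and> {(x, y)} \<in> P}" for z
    by (rule finite_subset[of _ "{0..<int w}"]) (use tiling_singleton_bounds[OF P] in auto)
  have k_skip: "?k x = ?k (x + 1)" if "{(x, y)} \<notin> P"
  proof -
    have "{u. x \<le> u \<and> {(u, y)} \<in> P} = {u. x + 1 \<le> u \<and> {(u, y)} \<in> P}"
      using that by (auto simp: order_le_less)
    then show ?thesis by simp
  qed
  have k_Suc: "?k x = Suc (?k (x + 1))" if "{(x, y)} \<in> P"
  proof -
    have "{u. x \<le> u \<and> {(u, y)} \<in> P} = insert x {u. x + 1 \<le> u \<and> {(u, y)} \<in> P}"
      using that by (auto simp: order_le_less)
    then show ?thesis using fin by simp
  qed
  obtain a b rs' where rs: "rs = (a, b) # rs'" "r = length rs'"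
    using Suc(2) by (cases rs) auto
  show ?case
  proof (cases a)
    case True
    have "(x, y) \<in> \<Union>Q"
      unfolding Suc.prems(2) rs using True by (simp add: covered_def x_def)
    then obtain q where q: "q \<in> Q" "(x, y) \<in> q" by blast
    \<comment> \<open>A monomino at this cell would coincide with \<open>q\<close>, but the
      singletons in \<open>Q\<close> lie before \<open>(x, y)\<close>.\<close>
    have "{(x, y)} \<notin> P"
      using meet[of q "{(x, y)}" "(x, y)"] q Suc.prems(1,4) unfolding x_def by blast
    then have k: "?k (int (length ((b, False) # ls))) = ?k (int (length ls))"
      using k_skip by (simp add: x_def add_ac)
    have "\<exists>Q' s. Q' \<subseteq> P \<and> \<Union>Q' = covered (y + 1) [] s \<and> length s = w \<and>
        (\<forall>x v. {(x, v)} \<in> Q' \<longrightarrow> v < y + 1) \<and>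
        fill_row (?k (int (length ((b, False) # ls))), (b, False) # ls, rs') s"
    proof (rule Suc.hyps(1))
      show "r = length rs'" "length ((b, False) # ls) + length rs' = w" "Q \<subseteq> P"
        using rs Suc.prems(1,3) by auto
      show "\<Union>Q = covered y ((b, False) # ls) rs'"
        using Suc.prems(2) rs True covered_skip by simp
      show "v < y \<or> v = y \<and> u < int (length ((b, False) # ls))" if "{(u, v)} \<in> Q" for u v
        using Suc.prems(4)[OF that] by auto
    qed
    then obtain Q' s where "Q' \<subseteq> P" "\<Union>Q' = covered (y + 1) [] s" "length s = w"
      "\<forall>x v. {(x, v)} \<in> Q' \<longrightarrow> v < y + 1" "fill_row (?k (int (length ls)), (b, False) # ls, rs') s"
      unfolding k by blast
    then show ?thesis
      using fill_row.skip True rs(1) by (intro exI[of _ Q'] exI[of _ s]) simp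
  next
    case False
    have xy: "(x, y) \<notin> \<Union>Q"
      using not_covered_head[OF y(1)] Suc.prems(2) rs False unfolding x_def by simp
    have "(x, y) \<in> rectangle w n"
      using y Suc.prems(3) rs unfolding rectangle_def x_def by auto
    then obtain p where p: "p \<in> P" "(x, y) \<in> p"
      using rect by blast
    have disj: "p \<inter> \<Union>Q = {}"
      using meet p xy Suc.prems(1) by blast
    have "\<exists>m. p = cells_of m (x, y) \<and> (m = M \<longleftrightarrow> is_monomino p)"
    proof (cases "is_monomino p")
      case True
      then show ?thesis
        using p(2) by (intro exI[of _ M]) (auto simp: is_monomino_def)
    next
      case False
      \<comment> \<open>All earlier cells in row-major order are covered by \<open>Q\<close>, which
        \<open>p\<close> does not meet; so \<open>(x, y)\<close> is the anchor of
        \<open>p\<close>.\<close>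
      have "y < v \<or> v = y \<and> x \<le> u" if uv: "(u, v) \<in> p" for u v
      proof (rule ccontr)
        assume *: "\<not> ?thesis"
        have "(u, v) \<in> rectangle w n"
          using uv p(1) rect by blast
        then have "(u, v) \<in> covered y ls rs"
          using * Suc.prems(3) unfolding covered_def rectangle_def x_def
          by (cases "v = y") (auto simp: left_cells_bottom)
        then show False
          using disj uv Suc.prems(2) by blast
      qed
      then show ?thesis
        using cells_of_lex_least[of p x y] tiles[OF p(1)] p(2) False is_T_tetromino_not_monomino by blast
    qed
    then obtain m where m: "p = cells_of m (x, y)" "m = M \<longleftrightarrow> is_monomino p"
      by blast
    have mono_iff: "m = M \<longleftrightarrow> {(x, y)} \<in> P"
      using m meet[of p "{(x, y)}" "(x, y)"] p by (auto simp: is_monomino_def)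
    have "\<exists>c. place m (?k x) ls ((False, b) # rs') = Some c"
    proof (rule place_exists)
      show "cells_of m (int (length ls), y) \<inter> covered y ls ((False, b) # rs') = {}"
        using disj m(1) Suc.prems(2) rs False unfolding x_def by simp
      show "cells_of m (int (length ls), y) \<subseteq> {0..<int (length ls + Suc (length rs'))} \<times> UNIV"
        using p(1) rect m(1) Suc.prems(3) rs unfolding x_def rectangle_def by fastforce
      show "0 < ?k x" if "m = M"
        using k_Suc mono_iff that by simp
    qed
    then obtain k' ls' rs'' where pl: "place m (?k x) ls ((False, b) # rs') = Some (k', ls', rs'')"
      by auto
    note len = place_length[OF pl]
    have k': "k' = ?k (int (length ls'))"
      using len(1,3) k_skip k_Suc mono_iff by (cases "m = M") (auto simp: x_def add_ac)
    have "\<exists>Q' s. Q' \<subseteq> P \<and> \<Union>Q' = covered (y + 1) [] s \<and> length s = w \<and>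
        (\<forall>x v. {(x, v)} \<in> Q' \<longrightarrow> v < y + 1) \<and> fill_row (?k (int (length ls')), ls', rs'') s"
    proof (rule Suc.hyps(1))
      show "r = length rs''" "length ls' + length rs'' = w"
        using rs len Suc.prems(3) by auto
      show "insert p Q \<subseteq> P"
        using p Suc.prems(1) by simp
      show "\<Union>(insert p Q) = covered y ls' rs''"
        using place_covered[OF pl] Suc.prems(2) rs False m(1) by (auto simp: x_def)
      show "v < y \<or> v = y \<and> u < int (length ls')" if "{(u, v)} \<in> insert p Q" for u v
        using that Suc.prems(4)[of u v] p(2) len(1) by (auto simp: x_def)
    qed
    then obtain Q' s where "Q' \<subseteq> P" "\<Union>Q' = covered (y + 1) [] s" "length s = w"
      "\<forall>x v. {(x, v)} \<in> Q' \<longrightarrow> v < y + 1" "fill_row (k', ls', rs'') s"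
      unfolding k' by blast
    then show ?thesis
      using fill_row.put[OF pl] False rs(1) unfolding x_def
      by (intro exI[of _ Q'] exI[of _ s]) simp
  qed
qed

text \<open>
  The profile \<open>s\<close> is what the pieces of \<open>P\<close> meeting a row below \<open>r\<close> leave above row \<open>r\<close>. The condition on
  singletons makes sure that each monomino is counted in its own row.
\<close>

definition front :: "cell set set \<Rightarrow> nat \<Rightarrow> nat \<Rightarrow> column list \<Rightarrow> bool" where
  "front P w r s \<longleftrightarrow> length s = w \<and>
     (\<exists>Q\<subseteq>P. \<Union>Q = covered (int r) [] s \<and> (\<forall>x v. {(x, v)} \<in> Q \<longrightarrow> v < int r))"

lemma front_step:
  assumes "is_tiling w n P" "front P w r s" "r < n"
  shows "\<exists>s'. front P w (Suc r) s' \<and> fill_row (row_count P (int r), [], s) s'"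
proof -
  obtain Q where Q: "Q \<subseteq> P" "\<Union>Q = covered (int r) [] s" "\<forall>x v. {(x, v)} \<in> Q \<longrightarrow> v < int r"
    and len: "length s = w"
    using assms(2) unfolding front_def by blast
  have "{x. int (length ([] :: column list)) \<le> x \<and> {(x, int r)} \<in> P} = {x. {(x, int r)} \<in> P}"
    using tiling_singleton_bounds[OF assms(1)] by auto
  moreover obtain Q' s' where "Q' \<subseteq> P" "\<Union>Q' = covered (int r + 1) [] s'" "length s' = w"
      "\<forall>x v. {(x, v)} \<in> Q' \<longrightarrow> v < int r + 1"
      "fill_row (card {x. int (length ([] :: column list)) \<le> x \<and> {(x, int r)} \<in> P}, [], s) s'"
    using tiling_fill_row[OF assms(1) _ _ Q(1,2)] len assms(3) Q(3) by fastforce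
  ultimately show ?thesis
    unfolding front_def row_count_def by (intro exI[of _ s']) (auto simp: add_ac)
qed

lemma front_walk:
  assumes "is_tiling w n P" "front P w r s" "r + d \<le> n"
  shows "\<exists>s'. front P w (r + d) s' \<and> walk d (\<Sum>y = r..<r + d. row_count P (int y)) s s'"
  using assms(3)
proof (induction d)
  case 0
  then show ?case
    using assms(2) walk_0 by auto
next
  case (Suc d)
  then obtain s' where s': "front P w (r + d) s'" "walk d (\<Sum>y = r..<r + d. row_count P (int y)) s s'"
    by auto
  obtain s'' where "front P w (Suc (r + d)) s''" "fill_row (row_count P (int (r + d)), [], s') s''"
    using front_step[OF assms(1) s'(1)] Suc.prems by auto
  then show ?case
    using walk_Suc[OF s'(2)] by (intro exI[of _ s'']) auto
qed

lemma right_cells_empty: "right_cells x y s = {} \<Longrightarrow> s = flat (length s)"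
  by (induction x y s rule: right_cells.induct) (auto split: if_splits)

text \<open>Cutting at height \<open>r\<close> keeps track of how the monominos are shared between
  the two parts. The final profile is flat because no piece leaves the rectangle at the top.\<close>

lemma tiling_walk:
  assumes "is_tiling w n P" "r \<le> n"
  shows "\<exists>s. walk r (\<Sum>y<r. row_count P (int y)) (flat w) s \<and>
    walk (n - r) (\<Sum>y = r..<n. row_count P (int y)) s (flat w)"
proof -
  have "front P w 0 (flat w)"
    unfolding front_def covered_def right_cells_flat by (auto intro: exI[of _ "{}"])
  then obtain s where s: "front P w r s" "walk r (\<Sum>y<r. row_count P (int y)) (flat w) s"
    using front_walk[OF assms(1), of 0 "flat w" r] assms(2) by (auto simp: lessThan_atLeast0)
  obtain s' where s': "front P w n s'" "walk (n - r) (\<Sum>y = r..<n. row_count P (int y)) s s'"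
    using front_walk[OF assms(1) s(1), of "n - r"] assms(2) by auto
  have "covered (int n) [] s' \<subseteq> rectangle w n"
    using s'(1) assms(1) partition_onD1 unfolding front_def is_tiling_def by blast
  then have "right_cells 0 (int n) s' \<subseteq> rectangle w n"
    by (auto simp: covered_def)
  then have "right_cells 0 (int n) s' = {}"
    using right_cells_subset[of 0 "int n" s'] unfolding rectangle_def by fastforce
  then have "s' = flat w"
    using right_cells_empty s'(1) unfolding front_def by auto
  then show ?thesis
    using s s' by blast
qed

lemma finite_tiling:
  assumes "is_tiling w n P"
  shows "finite P"
proof -
  have "finite (rectangle w n)"
    by (simp add: rectangle_def)
  then show ?thesis
    using assms partition_onD1 finite_UnionD unfolding is_tiling_def by metis
qed

section \<open>Counting monominos, and reflection\<close>

lemma card_monominos: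
  assumes "is_tiling w n P"
  shows "card {p \<in> P. is_monomino p} = (\<Sum>y<n. row_count P (int y))"
proof -
  let ?A = "SIGMA y:{..<n}. {x. {(x, int y)} \<in> P}"
  have fin: "finite {x. {(x, y)} \<in> P}" for y
    by (rule finite_subset[of _ "{0..<int w}"]) (use tiling_singleton_bounds[OF assms] in auto)
  have "bij_betw (\<lambda>(y, x). {(x, int y)}) ?A {p \<in> P. is_monomino p}"
    unfolding bij_betw_def
  proof
    show "inj_on (\<lambda>(y, x). {(x, int y)}) ?A"
      by (auto simp: inj_on_def)
    show "(\<lambda>(y, x). {(x, int y)}) ` ?A = {p \<in> P. is_monomino p}"
    proof (intro equalityI subsetI)
      fix p assume "p \<in> {p \<in> P. is_monomino p}"
      then obtain x y where p: "p = {(x, y)}" "{(x, y)} \<in> P"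
        by (auto simp: is_monomino_def)
      then show "p \<in> (\<lambda>(y, x). {(x, int y)}) ` ?A"
        using tiling_singleton_bounds[OF assms p(2)] by (intro image_eqI[of _ _ "(nat y, x)"]) auto
    qed (auto simp: is_monomino_def)
  qed
  then have "card {p \<in> P. is_monomino p} = card ?A"
    by (simp add: bij_betw_same_card)
  then show ?thesis
    using fin by (simp add: card_SigmaI row_count_def)
qed

text \<open>Cells are counted piece by piece: each tetromino contributes four and each monomino
  one.\<close>

lemma card_monominos_mod_4:
  assumes "is_tiling w n P"
  shows "[card {p \<in> P. is_monomino p} = w * n] (mod 4)"
proof -
  let ?B = "{p \<in> P. is_monomino p}"
  have part: "partition_on (rectangle w n) P"
    using assms by (simp add: is_tiling_def)
  have "finite (rectangle w n)"
    by (simp add: rectangle_def)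
  then have "finite p" if "p \<in> P" for p
    using that partition_onD1[OF part] by (auto intro: finite_subset)
  then have "card (rectangle w n) = (\<Sum>p\<in>P. card p)"
    using card_Union_disjoint[OF partition_onD2[OF part]] partition_onD1[OF part] by simp
  also have "\<dots> = (\<Sum>p\<in>P - ?B. card p) + (\<Sum>p\<in>?B. card p)"
    using finite_tiling[OF assms] by (intro sum.subset_diff) auto
  also have "(\<Sum>p\<in>?B. card p) = (\<Sum>p\<in>?B. 1)"
    by (rule sum.cong) (auto simp: is_monomino_def)
  also have "(\<Sum>p\<in>P - ?B. card p) = (\<Sum>p\<in>P - ?B. 4)"
    by (rule sum.cong) (use assms is_T_tetromino_card in \<open>auto simp: is_tiling_def\<close>)
  finally have "w * n = 4 * card (P - ?B) + card ?B"
    by (simp add: rectangle_def card_cartesian_product)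
  then show ?thesis
    by (simp add: cong_def)
qed

text \<open>Turning the rectangle upside down exchanges \<open>N\<close> with \<open>S\<close> and
  preserves \<open>E\<close> and \<open>W\<close>. It transfers what is known about the first rows
  to the last rows.\<close>

lemma tiling_reflect:
  assumes "is_tiling w n P"
  shows "\<exists>P'. is_tiling w n P' \<and> (\<forall>y<n. row_count P' (int y) = row_count P (int (n - Suc y)))"
proof -
  define f :: "cell \<Rightarrow> cell" where "f = (\<lambda>(x, y). (x, int n - 1 - y))"
  have ff: "f (f c) = c" for c
    by (cases c) (simp add: f_def)
  have inj: "inj f"
    using ff by (metis injI)
  have rect: "f ` rectangle w n = rectangle w n"
  proof (intro equalityI subsetI)
    fix c assume "c \<in> rectangle w n"
    then have "f c \<in> rectangle w n"
      by (auto simp: f_def rectangle_def)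
    then show "c \<in> f ` rectangle w n"
      using ff by (metis image_eqI)
  qed (auto simp: f_def rectangle_def)
  have T: "is_T_tetromino (f ` p)" if T_p: "is_T_tetromino p" for p
  proof -
    obtain m x y where "m \<noteq> M" "p = cells_of m (x, y)"
      using T_p by (auto simp: is_T_tetromino_iff)
    moreover have "f ` cells_of N (x, y) = cells_of S (x + 1, int n - 2 - y)"
      "f ` cells_of S (x, y) = cells_of N (x - 1, int n - 2 - y)"
      "f ` cells_of E (x, y) = cells_of E (x, int n - 3 - y)"
      "f ` cells_of W (x, y) = cells_of W (x, int n - 3 - y)"
      by (auto simp: f_def)
    ultimately show ?thesis
      unfolding is_T_tetromino_iff by (cases m) (metis piece.distinct)+
  qed
  have part: "partition_on (rectangle w n) P"
    using assms by (simp add: is_tiling_def)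
  have "(`) f ` P - {{}} = (`) f ` P"
    using partition_onD3[OF part] by auto
  then have "partition_on (rectangle w n) ((`) f ` P)"
    using partition_on_inj_image[OF part inj_on_subset[OF inj]] rect by simp
  moreover have "is_T_tetromino (f ` p) \<or> is_monomino (f ` p)" if "p \<in> P" for p
    using assms that T unfolding is_tiling_def is_monomino_def by fastforce
  ultimately have "is_tiling w n ((`) f ` P)"
    by (auto simp: is_tiling_def)
  moreover have "row_count ((`) f ` P) (int y) = row_count P (int (n - Suc y))" if "y < n" for y
  proof -
    have "{(x, int y)} \<in> (`) f ` P \<longleftrightarrow> {(x, int (n - Suc y))} \<in> P" for x
    proof -
      have "{(x, int y)} = f ` {(x, int (n - Suc y))}"
        using that by (auto simp: f_def)
      moreover have "inj ((`) f)"
        using inj_image_eq_iff[OF inj] by (intro injI) blast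
      ultimately show ?thesis
        by (simp only: inj_image_mem_iff)
    qed
    then show ?thesis
      by (simp add: row_count_def)
  qed
  ultimately show ?thesis
    by blast
qed

section \<open>Exhaustive search\<close>

text \<open>
  Sets of profiles are tries, indexed by the \<^emph>\<open>reversed\<close> profiles since these are what a completed row
  provides. The search threads a trie through its branches and avoids case distinctions on tries:
  evaluation by the simplifier would otherwise traverse the whole trie at every step.
\<close>

datatype pset = Nothing | Branch bool pset pset pset pset

fun ins :: "column list \<Rightarrow> pset \<Rightarrow> pset" where
  "ins [] Nothing = Branch True Nothing Nothing Nothing Nothing"
| "ins [] (Branch z a b c d) = Branch True a b c d"
| "ins ((False, False) # s) Nothing = Branch False (ins s Nothing) Nothing Nothing Nothing"
| "ins ((False, True) # s) Nothing = Branch False Nothing (ins s Nothing) Nothing Nothing"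
| "ins ((True, False) # s) Nothing = Branch False Nothing Nothing (ins s Nothing) Nothing"
| "ins ((True, True) # s) Nothing = Branch False Nothing Nothing Nothing (ins s Nothing)"
| "ins ((False, False) # s) (Branch z a b c d) = Branch z (ins s a) b c d"
| "ins ((False, True) # s) (Branch z a b c d) = Branch z a (ins s b) c d"
| "ins ((True, False) # s) (Branch z a b c d) = Branch z a b (ins s c) d"
| "ins ((True, True) # s) (Branch z a b c d) = Branch z a b c (ins s d)"

fun mem :: "column list \<Rightarrow> pset \<Rightarrow> bool" where
  "mem s Nothing = False"
| "mem [] (Branch z a b c d) = z"
| "mem ((False, False) # s) (Branch z a b c d) = mem s a"
| "mem ((False, True) # s) (Branch z a b c d) = mem s b"
| "mem ((True, False) # s) (Branch z a b c d) = mem s c"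
| "mem ((True, True) # s) (Branch z a b c d) = mem s d"

lemma mem_ins_same: "mem s (ins s t)"
  by (induction s t rule: ins.induct) auto

lemma mem_ins: "mem x t \<Longrightarrow> mem x (ins s t)"
proof (induction x t arbitrary: s rule: mem.induct)
  case (2 z a b c d)
  then show ?case by (cases "(s, Branch z a b c d)" rule: ins.cases) auto
next
  case (3 x z a b c d)
  then show ?case by (cases "(s, Branch z a b c d)" rule: ins.cases) auto
next
  case (4 x z a b c d)
  then show ?case by (cases "(s, Branch z a b c d)" rule: ins.cases) auto
next
  case (5 x z a b c d)
  then show ?case by (cases "(s, Branch z a b c d)" rule: ins.cases) auto
next
  case (6 x z a b c d)
  then show ?case by (cases "(s, Branch z a b c d)" rule: ins.cases) auto
qed simp

fun weight :: "config option \<Rightarrow> nat" where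
  "weight None = 0"
| "weight (Some (k, ls, rs)) = Suc (length rs)"

lemma weight_place: "weight (place m k ls rs) \<le> length rs"
  using place_length(2)[of m k ls rs]
  by (cases "place m k ls rs") (auto simp: less_eq_Suc_le)

text \<open>If the cell above the anchor is occupied, only \<open>N\<close> and \<open>M\<close> are
  tried, as the other three orientations use that cell. A branch that ends a row with monominos left
  over is discarded.\<close>

function fill :: "config option \<Rightarrow> pset \<Rightarrow> pset" where
  "fill None t = t"
| "fill (Some (0, ls, [])) t = ins ls t"
| "fill (Some (Suc k, ls, [])) t = t"
| "fill (Some (k, ls, (True, b) # rs)) t = fill (Some (k, (b, False) # ls, rs)) t"
| "fill (Some (k, ls, (False, True) # rs)) t =
     fill (north k ls ((False, True) # rs)) (fill (single k ls ((False, True) # rs)) t)"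
| "fill (Some (k, ls, (False, False) # rs)) t =
     fill (north k ls ((False, False) # rs)) (fill (east k ls ((False, False) # rs))
     (fill (south k ls ((False, False) # rs)) (fill (west k ls ((False, False) # rs))
     (fill (single k ls ((False, False) # rs)) t))))"
  by pat_completeness auto
termination
proof (relation "measure (\<lambda>(c, t). weight c)", goal_cases)
  case (3 k ls rs t)
  then show ?case using weight_place[of M k ls "(False, True) # rs"] by simp
next
  case (4 k ls rs t)
  then show ?case using weight_place[of N k ls "(False, True) # rs"] by simp
next
  case (5 k ls rs t)
  then show ?case using weight_place[of M k ls "(False, False) # rs"] by simp
next
  case (6 k ls rs t)
  then show ?case using weight_place[of W k ls "(False, False) # rs"] by simp
next
  case (7 k ls rs t)
  then show ?case using weight_place[of S k ls "(False, False) # rs"] by simp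
next
  case (8 k ls rs t)
  then show ?case using weight_place[of E k ls "(False, False) # rs"] by simp
next
  case (9 k ls rs t)
  then show ?case using weight_place[of N k ls "(False, False) # rs"] by simp
qed auto

text \<open>The path from the root is accumulated in reverse. As tries are indexed by reversed
  profiles, \<open>s\<close> is at a marked node the profile in its proper order.\<close>

fun rows :: "nat \<Rightarrow> column list \<Rightarrow> pset \<Rightarrow> pset \<Rightarrow> pset" where
  "rows j s Nothing u = u"
| "rows j s (Branch z a b c d) u = fill (if z then Some (j, [], s) else None)
     (rows j ((False, False) # s) a (rows j ((False, True) # s) b
     (rows j ((True, False) # s) c (rows j ((True, True) # s) d u))))"

text \<open>
  Reachable profiles are kept in a list of tries whose index is the number of monominos that may
  still be used. So \<open>layer j\<close> collects the profiles reached from the \<open>i\<close>-th trie with \<open>j + i\<close> monominos.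
\<close>

fun layer :: "nat \<Rightarrow> pset list \<Rightarrow> pset" where
  "layer j [] = Nothing"
| "layer j (F # Fs) = rows j [] F (layer (Suc j) Fs)"

fun advance :: "pset list \<Rightarrow> pset list" where
  "advance [] = []"
| "advance (F # Fs) = layer 0 (F # Fs) # advance Fs"

fun iter :: "nat \<Rightarrow> pset list \<Rightarrow> pset list" where
  "iter 0 Fs = Fs"
| "iter (Suc n) Fs = iter n (advance Fs)"

text \<open>The flat profile is its own reverse, so it is inserted as it stands.\<close>

definition start :: "nat \<Rightarrow> pset" where
  "start w = ins (flat w) Nothing"

text \<open>Only the head is inspected: it holds the profiles at which no monomino remains to be
  used.\<close>

fun avoids :: "nat \<Rightarrow> pset list \<Rightarrow> bool" where
  "avoids w [] = True"
| "avoids w (F # Fs) = (\<not> mem (flat w) F)"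

lemma mem_fill: "mem x t \<Longrightarrow> mem x (fill c t)"
  by (induction c t rule: fill.induct) (auto simp: mem_ins)

text \<open>Completeness of the search, by which absence from a trie excludes a walk. Results
  already collected survive the later branches by \<open>mem_fill\<close>.\<close>

lemma mem_fill_row: "fill_row c s \<Longrightarrow> mem (rev s) (fill (Some c) t)"
proof (induction arbitrary: t rule: fill_row.induct)
  case (put m k ls b rs c s)
  then show ?case
    by (cases b; cases m) (auto simp: mem_fill)
qed (auto simp: mem_ins_same)

lemma mem_rows_acc: "mem x u \<Longrightarrow> mem x (rows j s t u)"
  by (induction j s t u rule: rows.induct) (auto simp: mem_fill)

lemma mem_rows:
  "mem x t \<Longrightarrow> fill_row (j, [], rev x @ s) s' \<Longrightarrow> mem (rev s') (rows j s t u)"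
proof (induction x t arbitrary: s u rule: mem.induct)
  case (2 z a b c d)
  then show ?case
    by (simp add: mem_fill_row)
qed (simp_all add: mem_fill mem_rows_acc)

lemma mem_layer:
  assumes "i < length Fs" "mem (rev s) (Fs ! i)" "fill_row (j + i, [], s) s'"
  shows "mem (rev s') (layer j Fs)"
  using assms
proof (induction j Fs arbitrary: i rule: layer.induct)
  case (2 j F Fs)
  then show ?case
    using mem_rows[of "rev s" F j "[]" s'] by (cases i) (auto intro: mem_rows_acc)
qed simp

lemma length_advance: "length (advance Fs) = length Fs"
  by (induction Fs) auto

lemma advance_nth: "i < length Fs \<Longrightarrow> advance Fs ! i = layer 0 (drop i Fs)"
proof (induction Fs arbitrary: i)
  case (Cons F Fs)
  then show ?case
    by (cases i) auto
qed simp

lemma mem_advance: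
  assumes "j + i < length Fs" "mem (rev s) (Fs ! (j + i))" "fill_row (j, [], s) s'"
  shows "mem (rev s') (advance Fs ! i)"
  using assms mem_layer[of j "drop i Fs" s 0 s'] by (simp add: advance_nth add.commute)

lemma iter_Suc: "iter (Suc n) Fs = advance (iter n Fs)"
  by (induction n arbitrary: Fs) auto

lemma length_iter: "length (iter n Fs) = length Fs"
  by (induction n arbitrary: Fs) (auto simp: length_advance)

lemma mem_iter:
  assumes "walk r k s s'" "k + i < length Fs" "mem (rev s) (Fs ! (k + i))"
  shows "mem (rev s') (iter r Fs ! i)"
  using assms
proof (induction arbitrary: i rule: walk.induct)
  case (walk_Suc r k s s' j s'')
  then have "mem (rev s') (iter r Fs ! (j + i))"
    by (simp add: add.assoc)
  then show ?case
    unfolding iter_Suc using walk_Suc.hyps(2) walk_Suc.prems(1)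
    by (intro mem_advance) (auto simp: length_iter)
qed simp

lemma mem_start: "mem (flat w) (start w)"
  by (simp add: start_def mem_ins_same)

text \<open>
  Restarting the search from the flat profile every four rows treats all heights in a residue
  class modulo 4 at once.
\<close>

fun reseed :: "nat \<Rightarrow> pset list \<Rightarrow> pset list" where
  "reseed w [] = []"
| "reseed w [F] = [ins (flat w) F]"
| "reseed w (F # G # Fs) = F # reseed w (G # Fs)"

fun seeds :: "nat \<Rightarrow> nat \<Rightarrow> pset list" where
  "seeds w 0 = [Nothing, start w]"
| "seeds w (Suc q) = reseed w (iter 4 (seeds w q))"

lemma length_reseed: "length (reseed w Fs) = length Fs"
  by (induction w Fs rule: reseed.induct) auto

lemma mem_reseed: "i < length Fs \<Longrightarrow> mem x (Fs ! i) \<Longrightarrow> mem x (reseed w Fs ! i)"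
proof (induction w Fs arbitrary: i rule: reseed.induct)
  case (3 w F G Fs)
  then show ?case
    by (cases i) auto
qed (auto simp: mem_ins)

lemma mem_reseed_last: "length Fs = Suc i \<Longrightarrow> mem (flat w) (reseed w Fs ! i)"
proof (induction w Fs arbitrary: i rule: reseed.induct)
  case (3 w F G Fs)
  then show ?case
    by (cases i) auto
qed (auto simp: mem_ins_same)

lemma length_seeds: "length (seeds w q) = 2"
  by (induction q) (auto simp: length_reseed length_iter)

lemma mem_seeds_start: "mem (flat w) (seeds w q ! 1)"
  by (cases q) (auto simp: mem_start mem_reseed_last length_iter length_seeds)

text \<open>Reseeding only enlarges the tries, so a walk may enter at any stage \<open>q\<close> and
  is followed through the later stages. Its monominos lower the index from \<open>k + i\<close> to
  \<open>i\<close>.\<close>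

lemma mem_seeds:
  assumes "walk (4 * d) k s s'" "k + i < 2" "mem (rev s) (seeds w q ! (k + i))"
  shows "mem (rev s') (seeds w (q + d) ! i)"
  using assms
proof (induction d arbitrary: k i s')
  case 0
  then show ?case
    by (auto elim: walk.cases)
next
  case (Suc d)
  have "walk (4 * d + 4) k s s'"
    using Suc.prems(1) by (simp add: add.commute)
  then obtain k1 k2 u where u: "k = k1 + k2" "walk (4 * d) k1 s u" "walk 4 k2 u s'"
    using walk_split by blast
  have "mem (rev u) (seeds w (q + d) ! (k2 + i))"
    using Suc.IH[OF u(2), of "k2 + i"] Suc.prems u(1) by (simp add: add.assoc)
  then have "mem (rev s') (iter 4 (seeds w (q + d)) ! i)"
    using mem_iter[OF u(3)] Suc.prems(2) u(1) by (simp add: length_seeds)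
  then show ?case
    using Suc.prems(2) by (simp add: mem_reseed length_iter length_seeds)
qed

section \<open>Periodic and dying searches\<close>

fun stable :: "nat \<Rightarrow> pset list \<Rightarrow> bool" where
  "stable w Fs \<longleftrightarrow> iter 4 Fs = Fs \<and> \<not> avoids w Fs \<and>
     avoids w (iter 1 Fs) \<and> avoids w (iter 2 Fs) \<and> avoids w (iter 3 Fs)"

lemma walk_not_avoids:
  assumes "walk r k s (flat w)" "k < length Fs" "mem (rev s) (Fs ! k)"
  shows "\<not> avoids w (iter r Fs)"
proof -
  have "mem (flat w) (iter r Fs ! 0)"
    using mem_iter[OF assms(1), of 0] assms(2,3) by simp
  moreover have "iter r Fs \<noteq> []"
    using length_iter[of r Fs] assms(2) by auto
  ultimately show ?thesis
    by (cases "iter r Fs") auto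
qed

text \<open>The tries contain the flat profile and are fixed by four rows, so after
  \<open>4 * (n div 4)\<close> rows the walk is still among them. The remaining
  \<open>n mod 4\<close> rows can end flat only if there are none.\<close>

lemma stable_walk:
  assumes "stable w Fs" "Fs \<noteq> []" "walk n 0 (flat w) (flat w)"
  shows "4 dvd n"
proof -
  have step: "mem (rev u) (Fs ! 0)" if "walk (4 * q) 0 s u" "mem (rev s) (Fs ! 0)" for q s u
    using that
  proof (induction q arbitrary: s)
    case 0
    then show ?case
      by (auto elim: walk.cases)
  next
    case (Suc q)
    then have "walk (4 + 4 * q) 0 s u"
      by simp
    then obtain s' where s': "walk 4 0 s s'" "walk (4 * q) 0 s' u"
      using walk_split by fastforce
    then have "mem (rev s') (iter 4 Fs ! 0)"
      using mem_iter[OF s'(1), of 0 Fs] Suc.prems(2) assms(2) by simp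
    then show ?case
      using Suc.IH[OF s'(2)] assms(1) by simp
  qed
  have start: "mem (rev (flat w)) (Fs ! 0)"
    using assms(1,2) by (cases Fs) auto
  have "walk (4 * (n div 4) + n mod 4) 0 (flat w) (flat w)"
    using assms(3) by simp
  then obtain u where u: "walk (4 * (n div 4)) 0 (flat w) u" "walk (n mod 4) 0 u (flat w)"
    using walk_split by fastforce
  have "\<not> avoids w (iter (n mod 4) Fs)"
    using walk_not_avoids[OF u(2)] step[OF u(1) start] assms(2) by simp
  then have "n mod 4 \<noteq> 1 \<and> n mod 4 \<noteq> 2 \<and> n mod 4 \<noteq> 3"
    using assms(1) by auto
  moreover have "n mod 4 < 4"
    by simp
  ultimately show ?thesis
    by presburger
qed

text \<open>If no profile survives four rows, then all heights from four on are excluded; heights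
  two and three are checked directly.\<close>

lemma dead_walk:
  assumes "iter 4 [start w] = [Nothing] \<and>
      avoids w (iter 2 [start w]) \<and> avoids w (iter 3 [start w])"
    and "2 \<le> n"
  shows "\<not> walk n 0 (flat w) (flat w)"
proof
  assume walk: "walk n 0 (flat w) (flat w)"
  show False
  proof (cases "4 \<le> n")
    case True
    then have "walk (4 + (n - 4)) 0 (flat w) (flat w)"
      using walk by simp
    then obtain u where "walk 4 0 (flat w) u"
      using walk_split by fastforce
    then show False
      using mem_iter[of 4 0 "flat w" u 0 "[start w]"] assms(1) mem_start by simp
  next
    case False
    then have "n = 2 \<or> n = 3"
      using assms(2) by auto
    then show False
      using walk_not_avoids[OF walk, of "[start w]"] mem_start assms(1) by auto
  qed
qed

section \<open>Lower bounds\<close>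

text \<open>For widths 4, 8 and 12 the search without monominos is periodic after eight
  rows.\<close>

lemma stable_4: "stable 4 (iter 8 [start 4])"
  by code_simp

lemma stable_8: "stable 8 (iter 8 [start 8])"
  by code_simp

lemma stable_12: "stable 12 (iter 8 [start 12])"
  by code_simp

lemma dead_2: "iter 4 [start 2] = [Nothing] \<and>
    avoids 2 (iter 2 [start 2]) \<and> avoids 2 (iter 3 [start 2])"
  by code_simp

lemma dead_6: "iter 4 [start 6] = [Nothing] \<and>
    avoids 6 (iter 2 [start 6]) \<and> avoids 6 (iter 3 [start 6])"
  by code_simp

lemma dead_10: "iter 4 [start 10] = [Nothing] \<and>
    avoids 10 (iter 2 [start 10]) \<and> avoids 10 (iter 3 [start 10])"
  by code_simp

lemma avoids_10_3: "avoids 10 (iter 3 [Nothing, Nothing, start 10])"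
  by code_simp

text \<open>The stage \<open>seeds 10 4\<close> covers the first \<open>4 * q\<close> rows for all
  \<open>q \<le> 4\<close> at once, with at most one monomino spent through the three rows that
  follow. Prepending \<open>Nothing\<close> raises all indices by one, which releases the second
  monomino for the last four rows only.\<close>

lemma avoids_10: "avoids 10 (iter 4 (Nothing # iter 3 (seeds 10 4)))"
  by code_simp

lemma walk_0_dvd:
  assumes "w \<in> {2, 4, 6, 8, 10, 12}" "2 \<le> n" "walk n 0 (flat w) (flat w)"
  shows "4 dvd w \<and> 4 dvd n"
proof -
  consider "w \<in> {2, 6, 10}" | "w \<in> {4, 8, 12}"
    using assms(1) by blast
  then show ?thesis
  proof cases
    case 1
    then show ?thesis
      using dead_walk[OF dead_2] dead_walk[OF dead_6] dead_walk[OF dead_10] assms(2,3) by blast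
  next
    case 2
    have "iter 8 [start w] \<noteq> []"
      using length_iter[of 8 "[start w]"] by auto
    then have "4 dvd n"
      using 2 stable_walk[OF stable_4] stable_walk[OF stable_8] stable_walk[OF stable_12] assms(3)
      by auto
    then show ?thesis
      using 2 by auto
  qed
qed

lemma tiling_total_walk:
  assumes "is_tiling w n P"
  shows "walk n (card {p \<in> P. is_monomino p}) (flat w) (flat w)"
proof -
  obtain s where "walk n (\<Sum>y<n. row_count P (int y)) (flat w) s" "walk 0 0 s (flat w)"
    using tiling_walk[OF assms, of n] by auto
  then show ?thesis
    using card_monominos[OF assms] by (auto elim: walk.cases)
qed

lemma tiling_10_not_2:
  assumes "n \<in> {3, 7, 11, 15, 19, 23}" "is_tiling 10 n P"
  shows "card {p \<in> P. is_monomino p} \<noteq> 2"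
proof
  assume card2: "card {p \<in> P. is_monomino p} = 2"
  show False
  proof (cases "n = 3")
    case True
    have "walk 3 2 (flat 10) (flat 10)"
      using tiling_total_walk[OF assms(2)] card2 True by simp
    then show False
      using walk_not_avoids[of 3 2 "flat 10" 10 "[Nothing, Nothing, start 10]"] avoids_10_3 mem_start
      by simp
  next
    case False
    define q where "q = (n - 7) div 4"
    have n: "n = 4 * q + 3 + 4" "q \<le> 4"
      using assms(1) False unfolding q_def by auto
    define r where "r = 4 * q + 3"
    let ?f = "\<lambda>y. row_count P (int y)"
    have total: "(\<Sum>y<r. ?f y) + (\<Sum>y = r..<n. ?f y) = 2"
      using card2 card_monominos[OF assms(2)] n(1) sum.atLeastLessThan_concat[of 0 r n ?f]
      unfolding r_def by (simp add: lessThan_atLeast0)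
    \<comment> \<open>Otherwise the reflected tiling would start with four rows without monominos,
      contrary to \<open>dead_10\<close>.\<close>
    have late: "(\<Sum>y = r..<n. ?f y) \<noteq> 0"
    proof
      assume 0: "(\<Sum>y = r..<n. ?f y) = 0"
      obtain P' where P': "is_tiling 10 n P'"
          "\<forall>y<n. row_count P' (int y) = row_count P (int (n - Suc y))"
        using tiling_reflect[OF assms(2)] by blast
      have "row_count P' (int y) = 0" if "y < 4" for y
      proof -
        have "n - Suc y \<in> {r..<n}" "y < n"
          using that n(1) unfolding r_def by auto
        moreover have "\<forall>a\<in>{r..<n}. ?f a = 0"
          using 0 by simp
        ultimately show ?thesis
          using P'(2) by metis
      qed
      then have "(\<Sum>y<4. row_count P' (int y)) = 0"
        by simp
      then obtain u where "walk 4 0 (flat 10) u"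
        using tiling_walk[OF P'(1), of 4] n(1) by auto
      then show False
        using mem_iter[of 4 0 "flat 10" u 0 "[start 10]"] dead_10 mem_start by simp
    qed
    define k where "k = (\<Sum>y<r. ?f y)"
    have k: "k \<le> 1" "(\<Sum>y = r..<n. ?f y) = 2 - k"
      using total late unfolding k_def by arith+
    obtain s where s: "walk r k (flat 10) s" "walk 4 (2 - k) s (flat 10)"
      using tiling_walk[OF assms(2), of r] k(2) n(1) unfolding k_def r_def by auto
    obtain i j u where u: "k = i + j" "walk (4 * q) i (flat 10) u" "walk 3 j u s"
      using walk_split s(1) unfolding r_def by blast
    \<comment> \<open>Entering at stage \<open>4 - q\<close> makes the walk arrive at stage 4
      whatever \<open>q\<close> is, so one computation serves all five heights.\<close>
    have "mem (rev u) (seeds 10 (4 - q + q) ! (1 - i))"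
      using u(1) k(1) mem_seeds_start[of 10 "4 - q"] by (intro mem_seeds[OF u(2)]) auto
    then have "mem (rev u) (seeds 10 4 ! (j + (1 - k)))"
      using n(2) u(1) k(1) by simp
    then have "mem (rev s) (iter 3 (seeds 10 4) ! (1 - k))"
      using u(1) k(1) by (intro mem_iter[OF u(3)]) (auto simp: length_seeds)
    \<comment> \<open>The new index \<open>2 - k\<close> is the number of monominos in the last four
      rows.\<close>
    then have "mem (rev s) ((Nothing # iter 3 (seeds 10 4)) ! (2 - k))"
      using k(1) by (simp add: nth_Cons')
    moreover have "2 - k < length (Nothing # iter 3 (seeds 10 4))"
      by (simp add: length_iter length_seeds le_less_trans[OF diff_le_self])
    ultimately show False
      using walk_not_avoids[OF s(2)] avoids_10 by blast
  qed
qed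

section \<open>Families of tilings\<close>

text \<open>A tiling is given by the pieces anchored in each of its rows, from left to right.\<close>

fun play :: "piece list \<Rightarrow> config \<Rightarrow> column list option" where
  "play [] (0, ls, []) = Some (rev ls)"
| "play ms (k, ls, (True, b) # rs) = play ms (k, (b, False) # ls, rs)"
| "play (m # ms) (k, ls, (False, b) # rs) =
     (case place m k ls ((False, b) # rs) of None \<Rightarrow> None | Some c \<Rightarrow> play ms c)"
| "play _ _ = None"

fun run :: "piece list list \<Rightarrow> column list \<Rightarrow> column list option" where
  "run [] s = Some s"
| "run (ms # mss) s =
     (case play ms (count_list ms M, [], s) of None \<Rightarrow> None | Some s' \<Rightarrow> run mss s')"

lemma play_fill_row: "play ms c = Some s \<Longrightarrow> fill_row c s"
  by (induction ms c rule: play.induct) (auto intro: fill_row.intros split: option.splits)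

lemma run_walk: "run mss s = Some s' \<Longrightarrow> walk (length mss) (count_list (concat mss) M) s s'"
proof (induction mss s rule: run.induct)
  case (1 s)
  then show ?case
    using walk_0 by simp
next
  case (2 ms mss s)
  then obtain u where u: "play ms (count_list ms M, [], s) = Some u" "run mss u = Some s'"
    by (auto split: option.splits)
  have "walk (Suc 0) (count_list ms M) s u"
    using walk_Suc[OF walk_0 play_fill_row[OF u(1)]] by simp
  from walk_trans[OF 2(1)[OF u] this] show ?case
    by (simp add: count_list_append)
qed

lemma walk_of_run:
  assumes "run mss s = Some s' \<and> length mss = n \<and> count_list (concat mss) M = k"
  shows "walk n k s s'"
  using assms run_walk by blast

definition family ::
    "nat \<Rightarrow> nat \<Rightarrow> nat \<Rightarrow> piece list list \<Rightarrow> piece list list \<Rightarrow> piece list list \<Rightarrow> bool" where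
  "family w k n pre cyc post \<longleftrightarrow> (case run pre (flat w) of None \<Rightarrow> False
     | Some s \<Rightarrow> run cyc s = Some s \<and> run post s = Some (flat w)) \<and>
     length cyc = 4 \<and> count_list (concat cyc) M = 0 \<and>
     length pre + length post = n \<and> count_list (concat pre) M + count_list (concat post) M = k"

text \<open>\<open>cyc\<close> returns to the profile between \<open>pre\<close> and
  \<open>post\<close> without using a monomino, so it can be inserted any number of times.\<close>

lemma family_walk:
  assumes "family w k n pre cyc post"
  shows "walk (n + 4 * q) k (flat w) (flat w)"
proof -
  obtain s where s: "run pre (flat w) = Some s" "run cyc s = Some s" "run post s = Some (flat w)"
    using assms unfolding family_def by (auto split: option.splits)
  have cyc: "walk 4 0 s s"
    using run_walk[OF s(2)] assms unfolding family_def by simp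
  have "walk (4 * q) 0 s s"
  proof (induction q)
    case 0
    then show ?case
      using walk_0 by simp
  next
    case (Suc q)
    then show ?case
      using walk_trans[OF Suc cyc] by (simp add: add.commute)
  qed
  then have "walk (length pre + 4 * q) (count_list (concat pre) M) (flat w) s"
    using walk_trans[OF _ run_walk[OF s(1)]] by fastforce
  then show ?thesis
    using walk_trans[OF run_walk[OF s(3)]] assms unfolding family_def by (fastforce simp: add_ac)
qed

lemma walks_2_5_2: "walk (5 + 4 * q) 2 (flat 2) (flat 2)"
  by (rule family_walk[of _ _ _
     "[[M, W]]"
     "[[], [E], [], [W]]"
     "[[], [E], [], [M]]"])
    code_simp

lemma walks_2_3_2: "walk (3 + 4 * q) 2 (flat 2) (flat 2)"
  by (rule family_walk[of _ _ _
     "[[M, W]]"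
     "[[], [E], [], [W]]"
     "[[], [M]]"])
    code_simp

lemma walk_2_2: "walk 2 4 (flat 2) (flat 2)"
  by (rule walk_of_run[of
     "[[M, M], [M, M]]"])
    code_simp

lemma walks_2_4_4: "walk (4 + 4 * q) 4 (flat 2) (flat 2)"
  by (rule family_walk[of _ _ _
     "[[M, W]]"
     "[[], [E], [], [W]]"
     "[[], [M], [M, M]]"])
    code_simp

lemma walks_2_6_4: "walk (6 + 4 * q) 4 (flat 2) (flat 2)"
  by (rule family_walk[of _ _ _
     "[[M, W]]"
     "[[], [E], [], [W]]"
     "[[], [E], [], [M], [M, M]]"])
    code_simp

lemma walks_6_5_2: "walk (5 + 4 * q) 2 (flat 6) (flat 6)"
  by (rule family_walk[of _ _ _
     "[[N, N], [E, E, M, W]]"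
     "[[], [W, W, E], [], [E, E, W]]"
     "[[], [S, M, S], []]"])
    code_simp

lemma walks_6_3_2: "walk (3 + 4 * q) 2 (flat 6) (flat 6)"
  by (rule family_walk[of _ _ _
     "[[E, M, N, W]]"
     "[[S], [S], [N], [E, N, W]]"
     "[[S], [M]]"])
    code_simp

lemma walk_6_2: "walk 2 4 (flat 6) (flat 6)"
  by (rule walk_of_run[of
     "[[M, M, S, N], [M, M]]"])
    code_simp

lemma walks_6_4_4: "walk (4 + 4 * q) 4 (flat 6) (flat 6)"
  by (rule family_walk[of _ _ _
     "[[E, M, E, N]]"
     "[[W], [W, W], [E], [E, E]]"
     "[[W], [M, S], [M, M]]"])
    code_simp

lemma walks_6_6_4: "walk (6 + 4 * q) 4 (flat 6) (flat 6)"
  by (rule family_walk[of _ _ _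
     "[[E, M, E, N]]"
     "[[W], [W, W], [E], [E, E]]"
     "[[W], [W, W], [E], [M, S], [M, M]]"])
    code_simp

lemma walks_10_5_2: "walk (5 + 4 * q) 2 (flat 10) (flat 10)"
  by (rule family_walk[of _ _ _
     "[[N, S, N, N], [E, S, M, W]]"
     "[[N], [W, E, N, W, E], [S], [E, S, W]]"
     "[[N], [S, M, S, N, S], []]"])
    code_simp

text \<open>The smallest height congruent to 3 modulo 4 beyond the exceptions is 27. The 26 rows of
  \<open>post\<close> contain one monomino, in the very last row.\<close>

lemma walks_10_27_2: "walk (27 + 4 * q) 2 (flat 10) (flat 10)"
  by (rule family_walk[of _ _ _
     "[[E, N, S, M, N, W]]"
     "[[S], [W, N, S], [E, N], [E, S, N, W]]"
     "[[S], [W, N, E], [E, E, N], [E, W, W], [S, E], [W, S], [N, W], [E, E, E, N], [W, W], [W, S,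
     E], [S], [E, N, W], [S, E, N], [W, W], [N, S, E], [E, S], [N, W], [W, E, E, N], [W, W], [E,
     W, S], [S], [W, E, N], [S, E, N], [E, W], [S, N, S], [M]]"])
    code_simp

lemma walk_10_2: "walk 2 4 (flat 10) (flat 10)"
  by (rule walk_of_run[of
     "[[M, M, S, N, S, N], [M, M]]"])
    code_simp

lemma walks_10_4_4: "walk (4 + 4 * q) 4 (flat 10) (flat 10)"
  by (rule family_walk[of _ _ _
     "[[E, N, E, N, M, W]]"
     "[[W, W], [W, W, E], [E, E], [E, E, W]]"
     "[[W, W], [S, S, M], [M, M]]"])
    code_simp

lemma walks_10_6_4: "walk (6 + 4 * q) 4 (flat 10) (flat 10)"
  by (rule family_walk[of _ _ _
     "[[E, N, E, N, M, W]]"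
     "[[W, W], [W, W, E], [E, E], [E, E, W]]"
     "[[W, W], [S, S, E], [], [N, S, N, S, M], [M, M]]"])
    code_simp

lemma walk_10_3: "walk 3 6 (flat 10) (flat 10)"
  by (rule walk_of_run[of
     "[[M, W, M, N, N, W], [M, S, M, S], [M, M]]"])
    code_simp

lemma walks_10_7_6: "walk (7 + 4 * q) 6 (flat 10) (flat 10)"
  by (rule family_walk[of _ _ _
     "[[E, N, E, N, M, W]]"
     "[[W, W], [W, W, E], [E, E], [E, E, W]]"
     "[[W, W], [W, W, E], [E, E], [M, W, W], [M, S, M, S], [M, M]]"])
    code_simp

text \<open>For widths divisible by 4 the cycle starts and ends at the flat profile, hence tiles a
  block of four full rows, and \<open>pre\<close> is empty.\<close>

lemma walks_4_4_0: "walk (4 + 4 * q) 0 (flat 4) (flat 4)"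
  by (rule family_walk[of _ _ _
     "[]"
     "[[E, N], [W], [S], []]"
     "[[E, N], [W], [S], []]"])
    code_simp

lemma walks_4_5_4: "walk (5 + 4 * q) 4 (flat 4) (flat 4)"
  by (rule family_walk[of _ _ _
     "[]"
     "[[E, N], [W], [S], []]"
     "[[E, N], [W], [W], [M], [M, M, M]]"])
    code_simp

lemma walks_4_2_4: "walk (2 + 4 * q) 4 (flat 4) (flat 4)"
  by (rule family_walk[of _ _ _
     "[]"
     "[[E, N], [W], [S], []]"
     "[[M, N], [M, M, M]]"])
    code_simp

lemma walks_4_3_4: "walk (3 + 4 * q) 4 (flat 4) (flat 4)"
  by (rule family_walk[of _ _ _
     "[]"
     "[[E, N], [W], [S], []]"
     "[[E, N], [M], [M, M, M]]"])
    code_simp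

lemma walks_8_4_0: "walk (4 + 4 * q) 0 (flat 8) (flat 8)"
  by (rule family_walk[of _ _ _
     "[]"
     "[[E, N, S, N], [W], [S, N, S], []]"
     "[[E, N, S, N], [W], [S, N, S], []]"])
    code_simp

lemma walks_8_5_4: "walk (5 + 4 * q) 4 (flat 8) (flat 8)"
  by (rule family_walk[of _ _ _
     "[]"
     "[[E, N, S, N], [W], [S, N, S], []]"
     "[[E, N, W, N], [M, W], [N, M], [M, S, N, S], [M]]"])
    code_simp

lemma walks_8_2_4: "walk (2 + 4 * q) 4 (flat 8) (flat 8)"
  by (rule family_walk[of _ _ _
     "[]"
     "[[E, N, S, N], [W], [S, N, S], []]"
     "[[M, S, N, N], [M, M, M]]"])
    code_simp

lemma walks_8_3_4: "walk (3 + 4 * q) 4 (flat 8) (flat 8)"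
  by (rule family_walk[of _ _ _
     "[]"
     "[[E, N, S, N], [W], [S, N, S], []]"
     "[[M, N, N, W], [M, S, M, S], [M]]"])
    code_simp

lemma walks_12_4_0: "walk (4 + 4 * q) 0 (flat 12) (flat 12)"
  by (rule family_walk[of _ _ _
     "[]"
     "[[E, N, S, N, S, N], [W], [S, N, S, N, S], []]"
     "[[E, N, S, N, S, N], [W], [S, N, S, N, S], []]"])
    code_simp

lemma walks_12_5_4: "walk (5 + 4 * q) 4 (flat 12) (flat 12)"
  by (rule family_walk[of _ _ _
     "[]"
     "[[E, N, S, N, S, N], [W], [S, N, S, N, S], []]"
     "[[E, N, W, E, N, N], [M, W, W], [N, W, E], [M, S, M, S, S], [M]]"])
    code_simp

lemma walks_12_2_4: "walk (2 + 4 * q) 4 (flat 12) (flat 12)"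
  by (rule family_walk[of _ _ _
     "[]"
     "[[E, N, S, N, S, N], [W], [S, N, S, N, S], []]"
     "[[M, S, N, S, N, N], [M, M, M]]"])
    code_simp

lemma walks_12_3_4: "walk (3 + 4 * q) 4 (flat 12) (flat 12)"
  by (rule family_walk[of _ _ _
     "[]"
     "[[E, N, S, N, S, N], [W], [S, N, S, N, S], []]"
     "[[E, M, N, N, N, W], [S, M, S, M, S], [M]]"])
    code_simp

section \<open>Gap numbers\<close>

lemma gap_numberI:
  assumes "walk n k (flat w) (flat w)"
    and "\<And>P. is_tiling w n P \<Longrightarrow> k \<le> card {p \<in> P. is_monomino p}"
  shows "gap_number w n = k"
  unfolding gap_number_def using tiling_of_walk[OF assms(1)] assms(2) by (intro Least_equality) auto

lemma gap_number_0:
  assumes "w \<in> {4, 8, 12}" "4 dvd n" "2 \<le> n"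
  shows "gap_number w n = 0"
proof (rule gap_numberI)
  obtain q where "n = 4 + 4 * q"
    using assms(2,3) by (metis dvd_def less_eq_nat.simps(1) mult_0_right mult_Suc_right nat.exhaust not_numeral_le_zero)
  then show "walk n 0 (flat w) (flat w)"
    using assms(1) walks_4_4_0 walks_8_4_0 walks_12_4_0 by auto
qed simp

lemma gap_number_2:
  assumes "w \<in> {2, 6, 10}" "odd n" "2 \<le> n" "\<not> (w = 10 \<and> n \<in> {3, 7, 11, 15, 19, 23})"
  shows "gap_number w n = 2"
proof (rule gap_numberI)
  have mod: "n mod 4 = 1 \<or> n mod 4 = 3"
    using assms(2) by presburger
  define q where "q = n div 4"
  have n: "n = 4 * q + n mod 4"
    unfolding q_def by simp
  have 1: "\<exists>p. n = 5 + 4 * p" if "n mod 4 = 1"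
    using n that assms(3) by (intro exI[of _ "q - 1"]) auto
  have 3: "\<exists>p. n = 3 + 4 * p" if "n mod 4 = 3"
    using n that by (intro exI[of _ q]) auto
  have 27: "\<exists>p. n = 27 + 4 * p" if "n mod 4 = 3" "w = 10"
  proof -
    \<comment> \<open>These values of \<open>q\<close> give exactly the exceptional heights.\<close>
    have "q \<notin> {0, 1, 2, 3, 4, 5}"
      using n that assms(4) by auto
    then show ?thesis
      using n that(1) by (intro exI[of _ "q - 6"]) auto
  qed
  show "walk n 2 (flat w) (flat w)"
    using mod
  proof
    assume "n mod 4 = 1"
    then show ?thesis
      using 1 assms(1) walks_2_5_2 walks_6_5_2 walks_10_5_2 by auto
  next
    assume *: "n mod 4 = 3"
    show ?thesis
    proof (cases "w = 10")
      case True
      then show ?thesis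
        using 27[OF *] walks_10_27_2 by auto
    next
      case False
      then show ?thesis
        using 3[OF *] assms(1) walks_2_3_2 walks_6_3_2 by auto
    qed
  qed
  show "2 \<le> card {p \<in> P. is_monomino p}" if "is_tiling w n P" for P
  proof -
    have "w = 2 \<or> w = 6 \<or> w = 10"
      using assms(1) by simp
    then have "(w * n) mod 4 = 2"
      using assms(2) by (elim disjE; hypsubst; presburger)
    then show ?thesis
      using card_monominos_mod_4[OF that] unfolding cong_def by presburger
  qed
qed

text \<open>The number of monominos is 2 modulo 4 but not 2, hence at least 6.\<close>

lemma gap_number_6:
  assumes "n \<in> {3, 7, 11, 15, 19, 23}"
  shows "gap_number 10 n = 6"
proof (rule gap_numberI)
  have "n = 3 \<or> n = 7 + 4 * ((n - 7) div 4)"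
    using assms by auto
  then show "walk n 6 (flat 10) (flat 10)"
    using walk_10_3 walks_10_7_6[of "(n - 7) div 4"] by auto
  show "6 \<le> card {p \<in> P. is_monomino p}" if "is_tiling 10 n P" for P
  proof -
    have "(10 * n) mod 4 = 2"
      using assms by auto
    then have "card {p \<in> P. is_monomino p} mod 4 = 2"
      using card_monominos_mod_4[OF that] unfolding cong_def by simp
    then show ?thesis
      using tiling_10_not_2[OF assms that] by presburger
  qed
qed

text \<open>The number of monominos is a multiple of 4, and \<open>walk_0_dvd\<close> excludes
  zero.\<close>

lemma gap_number_4:
  assumes "w \<in> {2, 4, 6, 8, 10, 12}" "2 \<le> n" "4 dvd w * n" "\<not> (4 dvd w \<and> 4 dvd n)"
  shows "gap_number w n = 4"
proof (rule gap_numberI)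
  show "4 \<le> card {p \<in> P. is_monomino p}" if "is_tiling w n P" for P
  proof -
    have "card {p \<in> P. is_monomino p} \<noteq> 0"
      using tiling_total_walk[OF that] walk_0_dvd[OF assms(1,2)] assms(4) by metis
    moreover have "4 dvd card {p \<in> P. is_monomino p}"
      using card_monominos_mod_4[OF that] assms(3) by (simp add: cong_dvd_iff)
    ultimately show ?thesis
      by (simp add: dvd_imp_le)
  qed
  define q where "q = n div 4"
  have n: "n = 4 * q + n mod 4"
    unfolding q_def by simp
  show "walk n 4 (flat w) (flat w)"
  proof (cases "4 dvd w")
    case True
    then have "n mod 4 \<noteq> 0"
      using assms(4) by (auto simp: dvd_eq_mod_eq_0)
    then have "n mod 4 = 1 \<or> n mod 4 = 2 \<or> n mod 4 = 3"
      by presburger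
    then consider p where "n = 5 + 4 * p" | p where "n = 2 + 4 * p" | p where "n = 3 + 4 * p"
    proof (elim disjE)
      assume "n mod 4 = 1"
      then have "n = 5 + 4 * (q - 1)"
        using n assms(2) by auto
      then show ?thesis using that(1) by blast
    next
      assume "n mod 4 = 2"
      then show ?thesis using n that(2)[of q] by simp
    next
      assume "n mod 4 = 3"
      then show ?thesis using n that(3)[of q] by simp
    qed
    moreover have "w = 4 \<or> w = 8 \<or> w = 12"
      using assms(1) True by auto
    ultimately show ?thesis
      using walks_4_5_4 walks_4_2_4 walks_4_3_4 walks_8_5_4 walks_8_2_4 walks_8_3_4
        walks_12_5_4 walks_12_2_4 walks_12_3_4 by cases auto
  next
    case False
    then have w: "w = 2 \<or> w = 6 \<or> w = 10"
      using assms(1) by auto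
    then have "even n"
      using assms(3) by (elim disjE; hypsubst; presburger)
    then have "n mod 4 = 0 \<or> n mod 4 = 2"
      by presburger
    \<comment> \<open>The cyclic families for heights congruent to 2 modulo 4 begin at 6, so height
      2 has its own tiling.\<close>
    then consider p where "n = 4 + 4 * p" | "n = 2" | p where "n = 6 + 4 * p"
    proof (elim disjE)
      assume "n mod 4 = 0"
      then have "n = 4 + 4 * (q - 1)"
        using n assms(2) by auto
      then show ?thesis using that(1) by blast
    next
      assume *: "n mod 4 = 2"
      show ?thesis
      proof (cases "q = 0")
        case True
        then show ?thesis using n * that(2) by simp
      next
        case False
        then have "n = 6 + 4 * (q - 1)"
          using n * by auto
        then show ?thesis using that(3) by blast
      qed
    qed
    then show ?thesis
      using w walks_2_4_4 walk_2_2 walks_2_6_4 walks_6_4_4 walk_6_2 walks_6_6_4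
        walks_10_4_4 walk_10_2 walks_10_6_4 by cases auto
  qed
qed

theorem theorem4:
  fixes w n :: nat
  assumes "w \<in> {2, 4, 6, 8, 10, 12}" and "n \<ge> 2"
  shows "if w = 10 \<and> n \<in> {3, 7, 11, 15, 19, 23}
         then gap_number w n = 6
         else gap_number w n =
                (LEAST k. [k = w * n] (mod 4) \<and> (k = 0 \<longrightarrow> 4 dvd w \<and> 4 dvd n)) \<and>
              (4 dvd w \<and> 4 dvd n \<longrightarrow> gap_number w n = 0) \<and>
              ([w * n = 2] (mod 4) \<longrightarrow> gap_number w n = 2) \<and>
              ([w * n = 0] (mod 4) \<and> \<not> (4 dvd w \<and> 4 dvd n) \<longrightarrow> gap_number w n = 4)"
proof (cases "w = 10 \<and> n \<in> {3, 7, 11, 15, 19, 23}")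
  case True
  then show ?thesis
    using gap_number_6 by auto
next
  case False
  let ?L = "\<lambda>k. [k = w * n] (mod 4) \<and> (k = 0 \<longrightarrow> 4 dvd w \<and> 4 dvd n)"
  have "even w"
    using assms(1) by auto
  then have "even (w * n)"
    by simp
  then have "(w * n) mod 4 = 0 \<or> (w * n) mod 4 = 2"
    by presburger
  then consider "4 dvd w" "4 dvd n" | "(w * n) mod 4 = 2" | "(w * n) mod 4 = 0" "\<not> (4 dvd w \<and> 4 dvd n)"
    by (cases "4 dvd w \<and> 4 dvd n") auto
  then show ?thesis
  proof cases
    case 1
    then have "gap_number w n = 0"
      using assms by (intro gap_number_0) auto
    moreover have "(LEAST k. ?L k) = 0"
      using 1 by (intro Least_equality) (auto simp: cong_def)
    ultimately show ?thesis
      using False 1 by (auto simp: cong_def)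
  next
    case 2
    have "odd n"
    proof
      assume "even n"
      with \<open>even w\<close> have "4 dvd w * n"
        using mult_dvd_mono[of 2 w 2 n] by simp
      then show False
        using 2 by auto
    qed
    moreover have "\<not> 4 dvd w"
      using 2 dvd_mult2[of 4 w n] by (auto simp: dvd_eq_mod_eq_0)
    then have "w \<in> {2, 6, 10}"
      using assms(1) by auto
    ultimately have "gap_number w n = 2"
      using assms(2) False by (intro gap_number_2) auto
    moreover have "(LEAST k. ?L k) = 2"
    proof (rule Least_equality)
      show "2 \<le> k" if "?L k" for k
        using that 2 unfolding cong_def by presburger
    qed (use 2 in \<open>simp add: cong_def\<close>)
    ultimately show ?thesis
      using False 2 by (auto simp: cong_def)
  next
    case 3
    then have "gap_number w n = 4"
      using assms by (intro gap_number_4) auto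
    moreover have "(LEAST k. ?L k) = 4"
    proof (rule Least_equality)
      show "4 \<le> k" if "?L k" for k
      proof -
        have "k \<noteq> 0"
          using that 3(2) by blast
        then show ?thesis
          using that 3(1) unfolding cong_def by presburger
      qed
    qed (use 3 in \<open>simp add: cong_def\<close>)
    ultimately show ?thesis
      using False 3 by (auto simp: cong_def)
  qed
qed

end
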